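(* Let $\overline B:U\to\mathrm{Sym}(n)$ be a $C^k$ matrix-valued mapping, $k\ge1$, on an open neighborhood $U$ of $0$ in $\mathbb{R}^n$. Suppose that $\|\overline B\|_{C^k}\le\bar K$, and $$\overline B(0)=D_0=\mathrm{diag}(\pm1,\ldots,\pm1).$$ Let $$\delta=\frac{1}{4(\bar K+1)(\bar K+2)\left(1+(\bar K+2)^2\right)n(n+1)}.$$ Then there exists a $C^k$ mapping $\mathcal{Q}:U_\delta\to\Delta(n)$, where $U_\delta=U\cap\mathbf{B}^n_\delta$, such that $\mathcal{Q}(0)=I_n$, $\overline B(x)={}^t\mathcal{Q}(x)D_0\mathcal{Q}(x)$ for $x\in U_\delta$, and $$\|D\mathcal{Q}(x)\|\le(\bar K+1)\left(1+(\bar K+2)n(n+1)\right)\quad (x\in U_\delta),$$ and, for $k\ge2$, $\|\mathcal{Q}\|_{C^k}\le\overline C(\bar K,n,k)$, where $$\overline C(\bar K,n,k)=2^{k-1}(\bar K+1)\,EI\left(\bar K+1,\ (\bar K+1)(1+(\bar K+2)n(n+1)),\ k-1\right).$$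
   Context: $\mathrm{Sym}(n)$ is the space of real symmetric $n\times n$ matrices and $\Delta(n)$ the space of real upper triangular $n\times n$ matrices, with the norm $\|A\|=\max_{\|x\|=1}\|Ax\|$; ${}^tQ$ is the transpose of $Q$; $I_n$ is the identity matrix; $\mathbf{B}^n_\delta$ is the ball of radius $\delta$ centered at $0$ in $\mathbb{R}^n$. For a $C^k$ mapping $f$ on a domain $U$, $\|f\|_{C^k}=\max_{1\le p\le k}\sup_{x\in U}\|D^pf(x)\|$, with operator norms (the values of $f$ itself are not included). For $K_f,K_g\ge0$ and an integer $k\ge1$ put $E(K_f,K_g,k)=(1^k+2^k+\cdots+k^k)\,K_g\max(K_f,K_f^k)$. For $K,L>0$ and an integer $k\ge1$, the number $EI(K,L,k)$ is defined recursively: let $M_0=E\left(K,\max_{0\le p\le k-1}p!\,L^{p+1},k-1\right)$ (needed only when $k\ge2$), $M_1=L$, and $M_p=E(M_{p-1},M_0,p-1)$ for $p=2,\ldots,k$; then $EI(K,L,k)=M_k$.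
   Formalization: It is additionally assumed that for every x in U_δ the segment from 0 to x lies in U (true for U convex, star-shaped at 0, or containing the ball B_δ); for an arbitrary open neighborhood U of 0 the claim fails, e.g. n=1 with U disconnected and B=1 near 0, B=-1 on another piece inside B_δ. *)

theory Defs
  imports "HOL-Analysis.Analysis"
begin

definition sym_matrices :: "(real^'n^'n) set" where
  "sym_matrices = {A. transpose A = A}"

definition upper_triangular_matrices :: "(real^'n::{finite,wellorder}^'n::{finite,wellorder}) set" where
  "upper_triangular_matrices = {A. \<forall>i j. j < i \<longrightarrow> A $ i $ j = 0}"

text \<open>The default norm on \<^typ>\<open>real^'n^'m\<close> is the Frobenius norm;
  the norm used here on matrices is the operator norm.\<close>

definition mat_norm :: "real^'n^'m \<Rightarrow> real" where
  "mat_norm A = onorm ((*v) A)"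

text \<open>\<open>Deriv f [v\<^sub>1, \<dots>, v\<^sub>p] x\<close> is the value \<open>D\<^sup>p f(x)(v\<^sub>1, \<dots>, v\<^sub>p)\<close> of the
  \<open>p\<close>-th derivative, a \<open>p\<close>-linear map, read off from \<open>D\<^sup>p f = D(D\<^sup>p\<^sup>-\<^sup>1 f)\<close>.  It is
  meaningful on open sets on which \<open>f\<close> is \<open>C\<^sup>p\<close>; at points of such a set it only depends
  on the restriction of \<open>f\<close> to the set.\<close>

primrec Deriv :: "('a::real_normed_vector \<Rightarrow> 'b::real_normed_vector) \<Rightarrow> 'a list \<Rightarrow> 'a \<Rightarrow> 'b" where
  "Deriv f [] = f"
| "Deriv f (v # vs) = (\<lambda>x. frechet_derivative (Deriv f vs) (at x) v)"

text \<open>Continuity of the derivatives is required in each tuple of directions separately; over a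
  finite-dimensional domain this is continuity of \<open>D\<^sup>p f\<close> as a map into the \<open>p\<close>-linear maps.\<close>

definition Ck_on :: "nat \<Rightarrow> 'a::euclidean_space set \<Rightarrow> ('a \<Rightarrow> 'b::real_normed_vector) \<Rightarrow> bool" where
  "Ck_on k U f \<longleftrightarrow>
     (\<forall>vs. length vs < k \<longrightarrow> (\<forall>x\<in>U. Deriv f vs differentiable (at x))) \<and>
     (\<forall>vs. length vs \<le> k \<longrightarrow> continuous_on U (Deriv f vs))"

text \<open>The operator norm of \<open>D\<^sup>p f(x)\<close> for matrix-valued \<open>f\<close>.  Extended reals are used so that
  the suprema below are the true ones, also when they are infinite.\<close>

definition deriv_norm :: "nat \<Rightarrow> ('a::euclidean_space \<Rightarrow> real^'n^'m) \<Rightarrow> 'a \<Rightarrow> ereal" where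
  "deriv_norm p f x =
     (SUP vs\<in>{vs. length vs = p \<and> (\<forall>v\<in>set vs. norm v = 1)}. ereal (mat_norm (Deriv f vs x)))"

definition Ck_norm :: "nat \<Rightarrow> 'a::euclidean_space set \<Rightarrow> ('a \<Rightarrow> real^'n^'m) \<Rightarrow> ereal" where
  "Ck_norm k U f = (MAX p\<in>{1..k}. SUP x\<in>U. deriv_norm p f x)"

definition E_bound :: "real \<Rightarrow> real \<Rightarrow> nat \<Rightarrow> real" where
  "E_bound Kf Kg k = (\<Sum>i=1..k. real i ^ k) * Kg * max Kf (Kf ^ k)"

text \<open>The sequence \<open>M\<^sub>0, M\<^sub>1, \<dots>, M\<^sub>k\<close> whose last member is \<open>EI(K, L, k)\<close>; already
  \<open>M\<^sub>0\<close> depends on \<open>k\<close>.\<close>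

fun EI_seq :: "real \<Rightarrow> real \<Rightarrow> nat \<Rightarrow> nat \<Rightarrow> real" where
  "EI_seq K L k 0 = E_bound K (MAX p\<in>{0..k-1}. fact p * L ^ (p + 1)) (k - 1)"
| "EI_seq K L k (Suc 0) = L"
| "EI_seq K L k (Suc (Suc p)) = E_bound (EI_seq K L k (Suc p)) (EI_seq K L k 0) (Suc p)"

definition EI :: "real \<Rightarrow> real \<Rightarrow> nat \<Rightarrow> real" where
  "EI K L k = EI_seq K L k k"

definition C_bound :: "real \<Rightarrow> nat \<Rightarrow> nat \<Rightarrow> real" where
  "C_bound K n k =
     2 ^ (k - 1) * (K + 1) * EI (K + 1) ((K + 1) * (1 + (K + 2) * real n * (real n + 1))) (k - 1)"

end

theory Submission
  imports Defs
begin

text \<open>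
  Everything rests on the linear map \<open>T\<^sub>M V = V\<^sup>t D M + M\<^sup>t D V\<close> from upper triangular to
  symmetric matrices.  In the Frobenius norm \<open>norm V \<le> norm (T\<^sub>M V)\<close> as soon as \<open>M\<close> is close to
  the identity, because \<open>2 \<parallel>A\<parallel>\<^sup>2 \<le> \<parallel>A + A\<^sup>t\<parallel>\<^sup>2\<close> for upper triangular \<open>A\<close>.  A root \<open>Q(x)\<close> of
  \<open>Q\<^sup>t D Q = B(x)\<close> near the identity is found by the contraction principle, and
  \<open>Q(y) - Q(x)\<close> solves \<open>T\<^sub>M V = B(y) - B(x)\<close> exactly for the midpoint \<open>M\<close> of \<open>Q(x)\<close> and \<open>Q(y)\<close>,
  so \<open>Q\<close> is differentiable.  By Leibniz's rule each derivative \<open>V\<close> of \<open>Q\<close> of order \<open>p\<close> solves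
  \<open>T\<^sub>Q V = R\<close>, where \<open>R\<close> is a derivative of \<open>B\<close> minus \<open>2\<^sup>p - 2\<close> products of derivatives of
  \<open>Q\<close> of lower order.  This yields the regularity of \<open>Q\<close> and, with \<open>s = \<surd>n (K + 1)\<close>, the bound
  \<open>2\<^bsup>p(p-1)\<^esup> s\<^sup>p\<close> for \<open>V\<close>, which lies far below the constants of the statement.
\<close>

subsection \<open>Frobenius norm and triangular matrices\<close>

lemma power2_norm_matrix: "(norm A)\<^sup>2 = (\<Sum>i\<in>UNIV. \<Sum>j\<in>UNIV. (A $ i $ j)\<^sup>2)"
  for A :: "real^'n^'m"
  unfolding power2_norm_eq_inner by (simp add: inner_vec_def power2_eq_square)

text \<open>Row \<open>i\<close> of \<open>A ** B\<close> combines the rows of \<open>B\<close> with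
  the coefficients in row \<open>i\<close> of \<open>A\<close>, so Cauchy-Schwarz bounds it; then
  the squares are summed over the rows.\<close>

lemma norm_matrix_matrix_mult_le: "norm (A ** B) \<le> norm A * norm B"
  for A :: "real^'n^'m" and B :: "real^'p^'n"
proof -
  have row: "norm ((A ** B) $ i) \<le> norm (A $ i) * norm B" for i
  proof -
    have "(A ** B) $ i = (\<Sum>k\<in>UNIV. (A $ i $ k) *\<^sub>R (B $ k))"
      by (simp add: vec_eq_iff matrix_matrix_mult_def)
    then have "norm ((A ** B) $ i) \<le> (\<Sum>k\<in>UNIV. \<bar>A $ i $ k\<bar> * \<bar>norm (B $ k)\<bar>)"
      by (metis (no_types, lifting) abs_norm_cancel norm_scaleR sum.cong sum_norm_le order_refl)
    also have "\<dots> \<le> L2_set (\<lambda>k. A $ i $ k) UNIV * L2_set (\<lambda>k. norm (B $ k)) UNIV"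
      by (rule L2_set_mult_ineq)
    also have "\<dots> = norm (A $ i) * norm B"
      by (simp add: norm_vec_def L2_set_def)
    finally show ?thesis .
  qed
  have "norm (A ** B) \<le> L2_set (\<lambda>i. norm (A $ i) * norm B) UNIV"
    unfolding norm_vec_def[of "A ** B"] by (intro L2_set_mono row) auto
  also have "\<dots> = norm A * norm B"
    by (simp add: norm_vec_def[of A] L2_set_left_distrib)
  finally show ?thesis .
qed

lemma norm_transpose: "norm (transpose A) = norm A" for A :: "real^'n^'m"
proof -
  have "(norm (transpose A))\<^sup>2 = (norm A)\<^sup>2"
    unfolding power2_norm_matrix by (subst sum.swap) (simp add: transpose_def)
  then show ?thesis by simp
qed

lemma transpose_add: "transpose (A + B) = transpose A + transpose B"
  for A B :: "real^'n^'m"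
  by (simp add: transpose_def vec_eq_iff)

lemma matrix_diff_ldistrib: "A ** (B - C) = A ** B - A ** C"
  for A :: "real^'n^'m" and B C :: "real^'p^'n"
  using matrix_add_ldistrib[of A "B - C" C] by simp

lemma bounded_linear_transpose: "bounded_linear (transpose :: real^'n^'m \<Rightarrow> real^'m^'n)"
  by (rule bounded_linear_intro[where K = 1])
    (auto simp: transpose_add transpose_scalar norm_transpose)

lemma mat_norm_le_norm: "mat_norm A \<le> norm A" for A :: "real^'n^'m"
  unfolding mat_norm_def
proof (rule onorm_le)
  fix x
  have "norm (A *v x) \<le> L2_set (\<lambda>i. norm (A $ i) * norm x) UNIV"
    unfolding norm_vec_def[of "A *v x"]
    by (intro L2_set_mono)
       (auto simp: matrix_vector_mul_component Cauchy_Schwarz_ineq2)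
  also have "\<dots> = norm A * norm x"
    by (simp add: norm_vec_def[of A] L2_set_left_distrib)
  finally show "norm (A *v x) \<le> norm A * norm x" .
qed

lemma mat_norm_nonneg: "0 \<le> mat_norm A" for A :: "real^'n^'m"
  unfolding mat_norm_def by (rule onorm_pos_le) simp

text \<open>Each column is the image of a unit vector, and the squared Frobenius norm adds the
  squared lengths of the \<open>CARD('n)\<close> columns. This is the origin of the factor
  \<open>sqrt (real n)\<close> in the later bounds.\<close>

lemma norm_le_mat_norm: "norm A \<le> sqrt (real CARD('n)) * mat_norm A" for A :: "real^'n^'m"
proof -
  have col: "norm (column j A) \<le> mat_norm A" for j
    using onorm[OF matrix_vector_mul_bounded_linear, of A "axis j 1"]
    by (simp add: mat_norm_def matrix_vector_mult_basis)
  have "(norm A)\<^sup>2 = (\<Sum>j\<in>UNIV. (norm (column j A))\<^sup>2)"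
    unfolding power2_norm_matrix power2_norm_eq_inner
    by (subst sum.swap) (simp add: inner_vec_def column_def power2_eq_square)
  also have "\<dots> \<le> (\<Sum>j\<in>(UNIV :: 'n set). (mat_norm A)\<^sup>2)"
    by (intro sum_mono power_mono col) simp
  also have "\<dots> = (sqrt (real CARD('n)) * mat_norm A)\<^sup>2"
    by (simp add: power_mult_distrib)
  finally show ?thesis
    by (rule power2_le_imp_le) (simp add: mat_norm_nonneg)
qed

section \<open>Diagonal sign matrices\<close>

definition signature_matrix :: "real^'n^'n \<Rightarrow> bool" where
  "signature_matrix D \<longleftrightarrow>
     (\<exists>\<epsilon>. (\<forall>i. \<epsilon> i = 1 \<or> \<epsilon> i = -1) \<and> D = (\<chi> i j. if i = j then \<epsilon> i else 0))"

lemma diagonal_matrix_mult_component: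
  "((\<chi> i j. if i = j then \<epsilon> i else 0) ** A) $ i $ j = \<epsilon> i * A $ i $ j"
  for A :: "real^'m^'n"
proof -
  have "((\<chi> i j. if i = j then \<epsilon> i else 0) ** A) $ i $ j
      = (\<Sum>k\<in>UNIV. if i = k then \<epsilon> i * A $ k $ j else 0)"
    by (simp add: matrix_matrix_mult_def if_distrib[of "\<lambda>x. x * _"] cong: if_cong)
  then show ?thesis by simp
qed

lemma transpose_signature_matrix: "signature_matrix D \<Longrightarrow> transpose D = D"
  by (auto simp: signature_matrix_def transpose_def vec_eq_iff)

lemma norm_signature_matrix_mult: "signature_matrix D \<Longrightarrow> norm (D ** A) = norm A"
  for A :: "real^'m^'n"
proof -
  assume "signature_matrix D"
  then obtain \<epsilon> where e: "\<And>i. \<epsilon> i = 1 \<or> \<epsilon> i = -1" and D: "D = (\<chi> i j. if i = j then \<epsilon> i else 0)"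
    by (auto simp: signature_matrix_def)
  have sq: "(\<epsilon> i)\<^sup>2 = 1" for i using e[of i] by auto
  have "(norm (D ** A))\<^sup>2 = (norm A)\<^sup>2"
    unfolding power2_norm_matrix D diagonal_matrix_mult_component
    by (simp add: power_mult_distrib sq)
  then show ?thesis by simp
qed

lemma signature_matrix_involution: "signature_matrix D \<Longrightarrow> D ** (D ** A) = A"
  for A :: "real^'m^'n"
proof -
  assume "signature_matrix D"
  then obtain \<epsilon> where e: "\<And>i. \<epsilon> i = 1 \<or> \<epsilon> i = -1" and D: "D = (\<chi> i j. if i = j then \<epsilon> i else 0)"
    by (auto simp: signature_matrix_def)
  have "\<epsilon> i * (\<epsilon> i * x) = x" for i x using e[of i] by auto
  then show ?thesis
    by (simp add: vec_eq_iff D diagonal_matrix_mult_component)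
qed

lemma signature_matrix_mult_upper_triangular:
  "signature_matrix D \<Longrightarrow> A \<in> upper_triangular_matrices \<Longrightarrow> D ** A \<in> upper_triangular_matrices"
  by (auto simp: signature_matrix_def upper_triangular_matrices_def diagonal_matrix_mult_component)

section \<open>Upper triangular and symmetric matrices\<close>

lemma subspace_upper_triangular_matrices: "subspace upper_triangular_matrices"
  by (auto simp: subspace_def upper_triangular_matrices_def)

lemma subspace_sym_matrices: "subspace sym_matrices"
  by (auto simp: subspace_def sym_matrices_def transpose_add transpose_scalar
      vec_eq_iff transpose_def)

lemma mat_1_upper_triangular: "mat 1 \<in> upper_triangular_matrices"
  by (auto simp: upper_triangular_matrices_def mat_def)

text \<open>The inner product of \<open>A\<close> with its transpose only sees the squares of the diagonal.\<close>

lemma upper_triangular_norm_le_sum_transpose: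
  assumes "A \<in> upper_triangular_matrices"
  shows "sqrt 2 * norm A \<le> norm (A + transpose A)"
proof -
  have "A \<bullet> transpose A = (\<Sum>i\<in>UNIV. \<Sum>j\<in>UNIV. A $ i $ j * A $ j $ i)"
    by (simp add: inner_vec_def transpose_def)
  moreover have "0 \<le> A $ i $ j * A $ j $ i" for i j
    using assms by (cases i j rule: linorder_cases) (auto simp: upper_triangular_matrices_def)
  ultimately have "0 \<le> A \<bullet> transpose A"
    by (simp add: sum_nonneg)
  moreover have "(norm (A + transpose A))\<^sup>2
      = (norm A)\<^sup>2 + (norm (transpose A))\<^sup>2 + 2 * (A \<bullet> transpose A)"
    by (simp add: power2_norm_eq_inner inner_add_left inner_add_right inner_commute)
  ultimately have "(sqrt 2 * norm A)\<^sup>2 \<le> (norm (A + transpose A))\<^sup>2"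
    by (simp add: norm_transpose power_mult_distrib)
  then show ?thesis by (rule power2_le_imp_le) simp
qed

text \<open>On symmetric matrices this inverts \<open>A \<mapsto> A + transpose A\<close> restricted
  to upper triangular \<open>A\<close>; the diagonal is halved because that sum doubles it.\<close>

definition half_upper :: "real^'n::{finite,wellorder}^'n::{finite,wellorder} \<Rightarrow> real^'n::{finite,wellorder}^'n::{finite,wellorder}" where
  "half_upper S = (\<chi> i j. if i < j then S $ i $ j else if i = j then S $ i $ i / 2 else 0)"

lemma half_upper_upper_triangular: "half_upper S \<in> upper_triangular_matrices"
  by (auto simp: half_upper_def upper_triangular_matrices_def)

lemma half_upper_add_transpose:
  assumes "S \<in> sym_matrices" shows "half_upper S + transpose (half_upper S) = S"
proof -
  have "S $ i $ j = S $ j $ i" for i j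
    using assms by (metis (mono_tags) mem_Collect_eq sym_matrices_def transpose_def vec_lambda_beta)
  then show ?thesis
    by (auto simp: vec_eq_iff half_upper_def transpose_def)
qed

lemma norm_half_upper_le: "S \<in> sym_matrices \<Longrightarrow> sqrt 2 * norm (half_upper S) \<le> norm S"
  using upper_triangular_norm_le_sum_transpose[OF half_upper_upper_triangular, of S]
  by (simp add: half_upper_add_transpose)

lemma linear_half_upper: "linear half_upper"
  by (rule linearI) (auto simp: half_upper_def vec_eq_iff add_divide_distrib)

subsection \<open>The linearised congruence\<close>

definition cross_form :: "real^'n^'n \<Rightarrow> real^'n^'n \<Rightarrow> real^'n^'n \<Rightarrow> real^'n^'n" where
  "cross_form D A B = transpose A ** D ** B"

text \<open>The derivative of \<open>\<lambda>M. cross_form D M M\<close> at \<open>M\<close> in the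
  direction \<open>V\<close>.\<close>

definition sym_form :: "real^'n^'n \<Rightarrow> real^'n^'n \<Rightarrow> real^'n^'n \<Rightarrow> real^'n^'n" where
  "sym_form D M V = cross_form D V M + cross_form D M V"

lemma cross_form_add_left: "cross_form D (A + A') B = cross_form D A B + cross_form D A' B"
  by (simp add: cross_form_def transpose_add vec_eq_iff matrix_matrix_mult_def sum.distrib algebra_simps)

lemma cross_form_add_right: "cross_form D A (B + B') = cross_form D A B + cross_form D A B'"
  by (simp add: cross_form_def matrix_add_ldistrib)

lemma norm_cross_form_le:
  assumes "signature_matrix D" shows "norm (cross_form D A B) \<le> norm A * norm B"
proof -
  have "norm (transpose A ** (D ** B)) \<le> norm (transpose A) * norm (D ** B)"
    by (rule norm_matrix_matrix_mult_le)
  then show ?thesis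
    using assms by (simp add: cross_form_def norm_transpose norm_signature_matrix_mult matrix_mul_assoc)
qed

lemma bounded_bilinear_cross_form:
  assumes "signature_matrix D" shows "bounded_bilinear (cross_form D)"
proof
  show "\<exists>K. \<forall>a b. norm (cross_form D a b) \<le> norm a * norm b * K"
    using norm_cross_form_le[OF assms] by (intro exI[of _ 1]) simp
qed (simp_all only: cross_form_add_left cross_form_add_right, simp_all add: cross_form_def
      transpose_scalar matrix_scalar_ac scalar_matrix_assoc)

lemma sym_form_sym_matrices:
  assumes "signature_matrix D" shows "sym_form D M V \<in> sym_matrices"
  using transpose_signature_matrix[OF assms]
  by (simp add: sym_matrices_def sym_form_def cross_form_def transpose_add matrix_transpose_mul
      matrix_mul_assoc add.commute)

lemma bounded_bilinear_sym_form:
  assumes "signature_matrix D" shows "bounded_bilinear (sym_form D)"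
proof -
  interpret bounded_bilinear "cross_form D" by (rule bounded_bilinear_cross_form[OF assms])
  show ?thesis
  proof
    show "\<exists>K. \<forall>a b. norm (sym_form D a b) \<le> norm a * norm b * K"
    proof (intro exI[of _ 2] allI)
      fix a b
      show "norm (sym_form D a b) \<le> norm a * norm b * 2"
        using norm_triangle_ineq[of "cross_form D b a" "cross_form D a b"]
          norm_cross_form_le[OF assms, of b a] norm_cross_form_le[OF assms, of a b]
        by (simp add: sym_form_def mult.commute)
    qed
  qed (auto simp: sym_form_def add_left add_right scaleR_left scaleR_right algebra_simps)
qed

lemma norm_sym_form_le:
  assumes "signature_matrix D" shows "norm (sym_form D M V) \<le> 2 * norm M * norm V"
  using norm_triangle_ineq[of "cross_form D V M" "cross_form D M V"]
    norm_cross_form_le[OF assms, of V M] norm_cross_form_le[OF assms, of M V]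
  by (simp add: sym_form_def mult.commute[of "norm V"])

lemma sym_form_mat_1: "signature_matrix D \<Longrightarrow> sym_form D (mat 1) V = D ** V + transpose (D ** V)"
  by (simp add: sym_form_def cross_form_def matrix_transpose_mul transpose_signature_matrix)

text \<open>At \<open>mat 1\<close> the form is \<open>D ** V\<close> plus its transpose, which
  gains the factor \<open>sqrt 2\<close>; moving from \<open>mat 1\<close> to \<open>M\<close> costs
  at most 2 * 1/5.\<close>

lemma sym_form_bound:
  assumes D: "signature_matrix D" and M: "norm (M - mat 1) \<le> 1/5"
    and V: "V \<in> upper_triangular_matrices"
  shows "norm V \<le> norm (sym_form D M V)"
proof -
  interpret bounded_bilinear "sym_form D" by (rule bounded_bilinear_sym_form[OF D])
  have "sqrt 2 * norm V \<le> norm (sym_form D (mat 1) V)"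
    using upper_triangular_norm_le_sum_transpose[OF signature_matrix_mult_upper_triangular[OF D V]]
    by (simp add: sym_form_mat_1[OF D] norm_signature_matrix_mult[OF D])
  also have "sym_form D (mat 1) V = sym_form D M V - sym_form D (M - mat 1) V"
    by (simp add: diff_left)
  also have "norm \<dots> \<le> norm (sym_form D M V) + 2 * norm (M - mat 1) * norm V"
    using norm_triangle_ineq4[of "sym_form D M V" "sym_form D (M - mat 1) V"]
      norm_sym_form_le[OF D, of "M - mat 1" V] by linarith
  also have "\<dots> \<le> norm (sym_form D M V) + 2/5 * norm V"
    using mult_right_mono[OF M norm_ge_zero[of V]] by linarith
  finally have "sqrt 2 * norm V - 2/5 * norm V \<le> norm (sym_form D M V)" by simp
  \<comment> \<open>The radius 1/5 is chosen so that 7/5 - 2/5 leaves the constant 1.\<close>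
  moreover have "7/5 * norm V \<le> sqrt 2 * norm V"
    by (intro mult_right_mono real_le_rsqrt) (auto simp: power2_eq_square)
  ultimately show ?thesis by linarith
qed

text \<open>Inverting the form at \<open>mat 1\<close> turns the equation into a perturbation of the
  identity by a map of norm at most 2/5. This is injective, hence surjective in finite
  dimension.\<close>

lemma sym_form_surj:
  assumes D: "signature_matrix D" and M: "norm (M - mat 1) \<le> 1/5" and R: "R \<in> sym_matrices"
  obtains V where "V \<in> upper_triangular_matrices" "sym_form D M V = R"
proof -
  interpret T: bounded_bilinear "sym_form D" by (rule bounded_bilinear_sym_form[OF D])
  \<comment> \<open>On upper triangular matrices \<open>\<lambda>S. D ** half_upper S\<close> undoes
    \<open>sym_form D (mat 1)\<close>, so the equation becomes
    \<open>P V = D ** half_upper R\<close>. On the space of all matrices \<open>P\<close> is an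
    endomorphism.\<close>
  define P where "P = (\<lambda>V. V + D ** half_upper (sym_form D (M - mat 1) V))"
  have linP: "linear P"
    unfolding P_def
    by (intro linear_compose_add linear_id[unfolded id_def] linearI)
      (simp_all add: T.add_right T.scaleR_right linear_add[OF linear_half_upper]
        linear_scale[OF linear_half_upper] matrix_add_ldistrib matrix_scalar_ac scalar_matrix_assoc)
  have "V = 0" if "P V = 0" for V
  proof -
    let ?S = "sym_form D (M - mat 1) V"
    have "norm V = norm (D ** half_upper ?S)"
      using that unfolding P_def by (metis add_eq_0_iff norm_minus_cancel)
    also have "\<dots> = norm (half_upper ?S)" by (rule norm_signature_matrix_mult[OF D])
    also have "\<dots> \<le> sqrt 2 * norm (half_upper ?S)"
      using mult_right_mono[of 1 "sqrt 2" "norm (half_upper ?S)"] by simp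
    also have "\<dots> \<le> norm ?S" by (rule norm_half_upper_le[OF sym_form_sym_matrices[OF D]])
    also have "\<dots> \<le> 2 * norm (M - mat 1) * norm V" by (rule norm_sym_form_le[OF D])
    also have "\<dots> \<le> 2/5 * norm V" using mult_right_mono[OF M norm_ge_zero[of V]] by linarith
    finally show ?thesis by simp
  qed
  then have "inj P" by (simp add: linear_injective_0[OF linP])
  then have "surj P" by (rule linear_inj_imp_surj[OF linP])
  then obtain V where "P V = D ** half_upper R" by (metis surjD)
  let ?S = "sym_form D (M - mat 1) V"
  \<comment> \<open>This form of \<open>V\<close> shows that it is upper triangular, although
    \<open>P\<close> acts on all matrices.\<close>
  have V: "V = D ** half_upper (R - ?S)"
    using \<open>P V = _\<close> unfolding P_def
    by (simp add: linear_diff[OF linear_half_upper] matrix_diff_ldistrib eq_diff_eq)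
  have RS: "R - ?S \<in> sym_matrices"
    by (intro subspace_diff subspace_sym_matrices R sym_form_sym_matrices[OF D])
  have "sym_form D (mat 1) V = half_upper (R - ?S) + transpose (half_upper (R - ?S))"
    by (subst V) (simp add: sym_form_mat_1[OF D] signature_matrix_involution[OF D])
  also have "\<dots> = R - ?S" by (rule half_upper_add_transpose[OF RS])
  finally have "sym_form D M V = R" by (simp add: T.diff_left)
  moreover have "V \<in> upper_triangular_matrices"
    by (subst V) (intro signature_matrix_mult_upper_triangular[OF D] half_upper_upper_triangular)
  ultimately show ?thesis by (rule that[rotated])
qed

subsection \<open>Roots of the congruence equation\<close>

text \<open>For a quadratic map the mean value formula is exact, with the derivative taken at the
  midpoint.\<close>

lemma cross_form_diff_eq_sym_form:
  assumes D: "signature_matrix D"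
  shows "cross_form D P P - cross_form D Q Q = sym_form D ((1/2) *\<^sub>R (Q + P)) (P - Q)"
proof -
  interpret bounded_bilinear "cross_form D" by (rule bounded_bilinear_cross_form[OF D])
  have "sym_form D ((1/2) *\<^sub>R (Q + P)) (P - Q)
      = (1/2) *\<^sub>R (2 *\<^sub>R (cross_form D P P - cross_form D Q Q))"
    by (simp only: sym_form_def add_left add_right diff_left diff_right scaleR_left scaleR_right
        scaleR_2 scaleR_add_right[symmetric]) (simp add: algebra_simps)
  then show ?thesis by simp
qed

lemma norm_midpoint_diff_le:
  fixes P Q c :: "'a::real_normed_vector"
  assumes "norm (P - c) \<le> r" "norm (Q - c) \<le> r"
  shows "norm ((1/2) *\<^sub>R (P + Q) - c) \<le> r"
proof -
  have "(1/2) *\<^sub>R (P + Q) - c = (1/2) *\<^sub>R (P - c) + (1/2) *\<^sub>R (Q - c)"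
    by (simp add: algebra_simps flip: scaleR_add_left)
  then have "norm ((1/2) *\<^sub>R (P + Q) - c) \<le> 1/2 * norm (P - c) + 1/2 * norm (Q - c)"
    by (metis abs_of_nonneg norm_scaleR norm_triangle_ineq zero_le_divide_1_iff zero_le_numeral)
  then show ?thesis using assms by linarith
qed

text \<open>The midpoint of \<open>P\<close> and \<open>Q\<close> stays in the ball, so
  \<open>sym_form_bound\<close> applies there. Hence roots near the identity are unique and depend
  on the right-hand side with Lipschitz constant 1.\<close>

lemma congruence_root_dist_le:
  assumes D: "signature_matrix D"
    and P: "P \<in> upper_triangular_matrices" "norm (P - mat 1) \<le> 1/5"
    and Q: "Q \<in> upper_triangular_matrices" "norm (Q - mat 1) \<le> 1/5"
  shows "norm (P - Q) \<le> norm (cross_form D P P - cross_form D Q Q)"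
  unfolding cross_form_diff_eq_sym_form[OF D]
  by (intro sym_form_bound D norm_midpoint_diff_le P Q subspace_diff
      subspace_upper_triangular_matrices)

lemma congruence_root_exists:
  fixes D S :: "real^'n::{finite,wellorder}^'n::{finite,wellorder}"
  assumes D: "signature_matrix D" and S: "S \<in> sym_matrices" "norm (S - D) \<le> 1/5"
  obtains Q where "Q \<in> upper_triangular_matrices" "norm (Q - mat 1) \<le> 1/5" "cross_form D Q Q = S"
proof -
  interpret C: bounded_bilinear "cross_form D" by (rule bounded_bilinear_cross_form[OF D])
  have symC: "cross_form D E E \<in> sym_matrices" for E
    using transpose_signature_matrix[OF D]
    by (simp add: sym_matrices_def cross_form_def matrix_transpose_mul matrix_mul_assoc)
  have symD: "D \<in> sym_matrices"
    using transpose_signature_matrix[OF D] by (simp add: sym_matrices_def)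
  \<comment> \<open>With \<open>Q = mat 1 + E\<close> the equation reads
    \<open>sym_form D (mat 1) E = S - D - cross_form D E E\<close>; solving its linear part for
    \<open>E\<close> gives \<open>T E = E\<close>.\<close>
  define T where "T = (\<lambda>E. D ** half_upper (S - D - cross_form D E E))"
  have symT: "S - D - cross_form D E E \<in> sym_matrices" for E
    by (intro subspace_diff subspace_sym_matrices S symD symC)
  have norm_half: "7/5 * norm (D ** half_upper R) \<le> norm R" if "R \<in> sym_matrices" for R
  proof -
    have "7/5 * norm (half_upper R) \<le> sqrt 2 * norm (half_upper R)"
      by (intro mult_right_mono real_le_rsqrt) (auto simp: power2_eq_square)
    then show ?thesis
      using norm_half_upper_le[OF that] by (simp add: norm_signature_matrix_mult[OF D])
  qed
  \<comment> \<open>The image of the ball has radius at most 5/7 * (1/5 + 1/25) = 6/35 < 1/5, and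
    the Lipschitz constant is 5/7 * 2/5 = 2/7.\<close>
  have "\<exists>!E. E \<in> cball 0 (1/5) \<and> T E = E"
  proof (rule Banach_fix[where c = "2/7"])
    show "T ` cball 0 (1/5) \<subseteq> cball 0 (1/5)"
    proof (rule image_subsetI)
      fix E :: "real^'n::{finite,wellorder}^'n::{finite,wellorder}" assume "E \<in> cball 0 (1/5)"
      then have E: "norm E \<le> 1/5" by simp
      have "7/5 * norm (T E) \<le> norm (S - D - cross_form D E E)"
        unfolding T_def by (rule norm_half[OF symT])
      also have "\<dots> \<le> norm (S - D) + norm E * norm E"
        using norm_triangle_ineq4[of "S - D" "cross_form D E E"] norm_cross_form_le[OF D, of E E]
        by linarith
      also have "\<dots> \<le> 1/5 + 1/5 * (1/5)"
        using E by (intro add_mono S mult_mono) auto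
      finally show "T E \<in> cball 0 (1/5)" by simp
    qed
  next
    fix E F :: "real^'n::{finite,wellorder}^'n::{finite,wellorder}" assume EF: "E \<in> cball 0 (1/5)" "F \<in> cball 0 (1/5)"
    have "T E - T F = D ** half_upper (cross_form D F F - cross_form D E E)"
      unfolding T_def
      by (simp add: matrix_diff_ldistrib[symmetric] linear_diff[OF linear_half_upper, symmetric])
    then have "7/5 * norm (T E - T F) \<le> norm (cross_form D F F - cross_form D E E)"
      by (metis norm_half subspace_diff subspace_sym_matrices symC)
    also have "\<dots> \<le> 2 * norm ((1/2) *\<^sub>R (E + F)) * norm (F - E)"
      unfolding cross_form_diff_eq_sym_form[OF D] by (rule norm_sym_form_le[OF D])
    also have "\<dots> \<le> 2 * (1/5) * norm (F - E)"
      using EF norm_midpoint_diff_le[of E 0 "1/5" F]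
      by (intro mult_right_mono mult_left_mono) auto
    finally show "dist (T E) (T F) \<le> 2/7 * dist E F"
      by (simp add: dist_norm norm_minus_commute)
  qed (auto simp: complete_eq_closed)
  then obtain E where E: "norm E \<le> 1/5" "T E = E" by auto
  let ?R = "S - D - cross_form D E E"
  have "D ** E = half_upper ?R"
    by (metis E(2) T_def signature_matrix_involution[OF D])
  then have "sym_form D (mat 1) E = ?R"
    by (simp add: sym_form_mat_1[OF D] half_upper_add_transpose[OF symT])
  then have "cross_form D (mat 1 + E) (mat 1 + E) = S"
    by (simp add: C.add_left C.add_right sym_form_def) (simp add: cross_form_def algebra_simps)
  \<comment> \<open>The iteration runs over all matrices, but a fixed point lies in the range of
    \<open>T\<close>.\<close>
  moreover have "E \<in> upper_triangular_matrices"
    by (metis E(2) T_def D signature_matrix_mult_upper_triangular half_upper_upper_triangular)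
  then have "mat 1 + E \<in> upper_triangular_matrices"
    by (intro subspace_add subspace_upper_triangular_matrices mat_1_upper_triangular)
  ultimately show ?thesis using E(1) by (intro that[of "mat 1 + E"]) auto
qed

section \<open>Differentiability and continuity of solutions of the linear equation\<close>

lemma has_derivative_sym_matrices:
  assumes "open W" "x \<in> W" "\<And>y. y \<in> W \<Longrightarrow> G y \<in> sym_matrices" "(G has_derivative G') (at x)"
  shows "G' h \<in> sym_matrices"
proof -
  have "((\<lambda>y. transpose (G y)) has_derivative (\<lambda>h. transpose (G' h))) (at x)"
    by (rule bounded_linear.has_derivative[OF bounded_linear_transpose assms(4)])
  then have "(G has_derivative (\<lambda>h. transpose (G' h))) (at x)"
    by (rule has_derivative_transform_within_open) (use assms in \<open>auto simp: sym_matrices_def\<close>)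
  then have "G' = (\<lambda>h. transpose (G' h))"
    using assms(4) by (metis has_derivative_unique)
  from fun_cong[OF this, of h] show ?thesis by (simp add: sym_matrices_def)
qed

text \<open>Dividing the equation by the increment suggests that \<open>F'\<close> solves it with
  \<open>M x\<close> and \<open>G'\<close>, and \<open>sym_form_bound\<close> controls the error.
  Only continuity of \<open>M\<close> is asked, since for the first derivative of the root
  \<open>M\<close> contains the root itself.\<close>

lemma sym_form_solution_has_derivative:
  fixes F G :: "'a::euclidean_space \<Rightarrow> real^'n::{finite,wellorder}^'n::{finite,wellorder}"
  assumes D: "signature_matrix D" and W: "open W" "x \<in> W"
    and M: "\<And>y. y \<in> W \<Longrightarrow> norm (M y - mat 1) \<le> 1/5" "isCont M x"
    and F: "\<And>y. y \<in> W \<Longrightarrow> F y \<in> upper_triangular_matrices"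
    and G: "(G has_derivative G') (at x)"
    and eq: "\<And>y. y \<in> W \<Longrightarrow> sym_form D (M y) (F y - F x) = G y"
  obtains F' where "(F has_derivative F') (at x)" "\<And>h. F' h \<in> upper_triangular_matrices"
    "\<And>h. sym_form D (M x) (F' h) = G' h"
proof -
  interpret T: bounded_bilinear "sym_form D" by (rule bounded_bilinear_sym_form[OF D])
  have symG: "G y \<in> sym_matrices" if "y \<in> W" for y
    using eq[OF that] sym_form_sym_matrices[OF D] by metis
  have G0: "G x = 0" using eq[OF W(2)] by (simp add: T.zero_right)
  \<comment> \<open>A derivative of the symmetric-valued \<open>G\<close> has symmetric values, so
    every \<open>G' h\<close> has a preimage; its uniqueness then makes \<open>F'\<close>
    linear.\<close>
  have "\<exists>V. V \<in> upper_triangular_matrices \<and> sym_form D (M x) V = G' h" for h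
    using sym_form_surj[OF D M(1)[OF W(2)] has_derivative_sym_matrices[OF W symG G]] by metis
  then obtain F' where F': "\<And>h. F' h \<in> upper_triangular_matrices"
    "\<And>h. sym_form D (M x) (F' h) = G' h" by metis
  have inj: "V = V'" if "V \<in> upper_triangular_matrices" "V' \<in> upper_triangular_matrices"
    "sym_form D (M x) V = sym_form D (M x) V'" for V V'
    using sym_form_bound[OF D M(1)[OF W(2)]
        subspace_diff[OF subspace_upper_triangular_matrices that(1,2)]] that(3)
    by (simp add: T.diff_right)
  interpret G': bounded_linear G' by (rule has_derivative_bounded_linear[OF G])
  have "linear F'"
  proof (rule linearI)
    show "F' (h + h') = F' h + F' h'" for h h'
      by (rule inj) (simp_all add: F' subspace_add[OF subspace_upper_triangular_matrices]
          T.add_right G'.add)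
    show "F' (c *\<^sub>R h) = c *\<^sub>R F' h" for c h
      by (rule inj) (simp_all add: F' subspace_scale[OF subspace_upper_triangular_matrices]
          T.scaleR_right G'.scaleR)
  qed
  then have blF': "bounded_linear F'" by (simp add: linear_conv_bounded_linear)
  obtain C where C: "\<And>h. norm (G' h) \<le> norm h * C" using G'.bounded by blast
  define e where "e = (\<lambda>y. norm (G y - G x - G' (y - x)) / norm (y - x))"
  have e0: "(e \<longlongrightarrow> 0) (at x)" using G unfolding has_derivative_iff_norm e_def by blast
  obtain d where d: "d > 0" "ball x d \<subseteq> W" using W openE by blast
  have "(F has_derivative F') (at x)"
  \<comment> \<open>Here \<open>e y\<close> is the relative linearisation error of \<open>G\<close>
    and \<open>e y + C\<close> bounds the difference quotient of \<open>F\<close>; the second term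
    is the cost of replacing \<open>M y\<close> by \<open>M x\<close>.\<close>
  proof (rule has_derivativeI_sandwich[where H = "\<lambda>y. e y + 2 * norm (M y - M x) * (e y + C)"])
    show "0 < d" by fact
    show "bounded_linear F'" by fact
    have "((\<lambda>y. norm (M y - M x)) \<longlongrightarrow> 0) (at x)"
      using M(2) by (simp add: isCont_def tendsto_norm_zero LIM_zero)
    then have "((\<lambda>y. e y + 2 * norm (M y - M x) * (e y + C)) \<longlongrightarrow> 0 + 2 * 0 * (0 + C)) (at x)"
      by (intro tendsto_intros e0)
    then show "((\<lambda>y. e y + 2 * norm (M y - M x) * (e y + C)) \<longlongrightarrow> 0) (at x)" by simp
  next
    fix y assume y: "y \<noteq> x" "dist y x < d"
    then have yW: "y \<in> W" using d by (auto simp: dist_commute)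
    have pos: "0 < norm (y - x)" using y by simp
    let ?E = "norm (G y - G x - G' (y - x))"
    have E: "?E = e y * norm (y - x)" using pos by (simp add: e_def)
    have "norm (F y - F x) \<le> norm (G y)"
      unfolding eq[OF yW, symmetric]
      by (intro sym_form_bound D M yW subspace_diff subspace_upper_triangular_matrices F W)
    also have "\<dots> \<le> ?E + norm (G' (y - x))"
      using norm_triangle_ineq[of "G y - G x - G' (y - x)" "G' (y - x)"] by (simp add: G0)
    also have "\<dots> \<le> (e y + C) * norm (y - x)"
      using C[of "y - x"] unfolding E by (simp add: algebra_simps)
    finally have Fyx: "norm (F y - F x) \<le> (e y + C) * norm (y - x)" .
    have "norm (F y - F x - F' (y - x)) \<le> norm (sym_form D (M x) (F y - F x - F' (y - x)))"
      by (intro sym_form_bound D M W subspace_diff subspace_upper_triangular_matrices F yW F')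
    also have "sym_form D (M x) (F y - F x - F' (y - x))
        = (G y - G x - G' (y - x)) - sym_form D (M y - M x) (F y - F x)"
      unfolding T.diff_right[of _ "F y - F x"] T.diff_left eq[OF yW] F'(2) by (simp add: G0)
    also have "norm \<dots> \<le> ?E + 2 * norm (M y - M x) * norm (F y - F x)"
      using norm_triangle_ineq4 norm_sym_form_le[OF D] by (smt (verit))
    also have "\<dots> \<le> ?E + 2 * norm (M y - M x) * ((e y + C) * norm (y - x))"
      by (intro add_left_mono mult_left_mono Fyx) simp
    also have "\<dots> = (e y + 2 * norm (M y - M x) * (e y + C)) * norm (y - x)"
      unfolding E by (simp add: algebra_simps)
    finally show "norm (F y - F x - F' (y - x)) / norm (y - x)
        \<le> e y + 2 * norm (M y - M x) * (e y + C)"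
      using pos by (simp add: divide_le_eq)
  qed
  then show ?thesis using F' by (rule that)
qed

lemma sym_form_solution_continuous_on:
  assumes D: "signature_matrix D"
    and M: "\<And>y. y \<in> W \<Longrightarrow> norm (M y - mat 1) \<le> 1/5" "continuous_on W M"
    and F: "\<And>y. y \<in> W \<Longrightarrow> F y \<in> upper_triangular_matrices"
    and cont: "continuous_on W (\<lambda>y. sym_form D (M y) (F y))"
  shows "continuous_on W F"
  unfolding continuous_on_def
proof
  fix x assume x: "x \<in> W"
  interpret T: bounded_bilinear "sym_form D" by (rule bounded_bilinear_sym_form[OF D])
  let ?H = "\<lambda>y. sym_form D (M y) (F y) - sym_form D (M y) (F x)"
  have "continuous_on W ?H"
    by (intro continuous_on_diff cont T.continuous_on M continuous_on_const)
  then have "(?H \<longlongrightarrow> ?H x) (at x within W)"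
    unfolding continuous_on_def using x by blast
  then have "(?H \<longlongrightarrow> 0) (at x within W)" by simp
  then have "((\<lambda>y. norm (?H y)) \<longlongrightarrow> 0) (at x within W)" by (rule tendsto_norm_zero)
  moreover have "\<forall>\<^sub>F y in at x within W. norm (F y - F x) \<le> norm (?H y)"
    unfolding eventually_at_filter
    by (rule always_eventually)
      (auto simp flip: T.diff_right
        intro!: sym_form_bound D M F x subspace_diff subspace_upper_triangular_matrices)
  ultimately have "((\<lambda>y. F y - F x) \<longlongrightarrow> 0) (at x within W)"
    by (rule Lim_null_comparison[rotated])
  then show "(F \<longlongrightarrow> F x) (at x within W)" by (simp add: LIM_zero_iff)
qed

subsection \<open>Higher derivatives of the root\<close>

text \<open>The ordered pairs of nonempty complementary subsequences, as they occur in Leibniz's rule.\<close>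

fun proper_splits :: "'a list \<Rightarrow> ('a list \<times> 'a list) list" where
  "proper_splits [] = []"
| "proper_splits [v] = []"
| "proper_splits (v # w # vs) = ([v], w # vs) # (w # vs, [v]) #
     map (\<lambda>(a, b). (v # a, b)) (proper_splits (w # vs)) @
     map (\<lambda>(a, b). (a, v # b)) (proper_splits (w # vs))"

lemma proper_splits_Cons:
  "vs \<noteq> [] \<Longrightarrow> proper_splits (v # vs) = ([v], vs) # (vs, [v]) #
     map (\<lambda>(a, b). (v # a, b)) (proper_splits vs) @ map (\<lambda>(a, b). (a, v # b)) (proper_splits vs)"
  by (cases vs) auto

lemma proper_splitsD:
  assumes "(a, b) \<in> set (proper_splits vs)"
  shows "a \<noteq> []" "b \<noteq> []" "length a + length b = length vs" "set a \<subseteq> set vs" "set b \<subseteq> set vs"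
proof -
  have "a \<noteq> [] \<and> b \<noteq> [] \<and> length a + length b = length vs \<and> set a \<subseteq> set vs \<and> set b \<subseteq> set vs"
    using assms by (induction vs arbitrary: a b rule: proper_splits.induct) fastforce+
  then show "a \<noteq> []" "b \<noteq> []" "length a + length b = length vs" "set a \<subseteq> set vs" "set b \<subseteq> set vs"
    by auto
qed

text \<open>A split chooses a side for each entry, the two constant choices being excluded. Adding 2
  on the left avoids truncated subtraction.\<close>

lemma length_proper_splits: "vs \<noteq> [] \<Longrightarrow> length (proper_splits vs) + 2 = 2 ^ length vs"
  by (induction vs rule: proper_splits.induct) auto

lemma has_derivative_sum_list:
  assumes "\<And>p. p \<in> set ps \<Longrightarrow> (f p has_derivative f' p) F"
  shows "((\<lambda>x. \<Sum>p\<leftarrow>ps. f p x) has_derivative (\<lambda>h. \<Sum>p\<leftarrow>ps. f' p h)) F"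
  using assms by (induction ps) (auto intro!: has_derivative_add)

lemma continuous_on_sum_list:
  fixes f :: "'b \<Rightarrow> 'a::topological_space \<Rightarrow> 'c::topological_monoid_add"
  assumes "\<And>p. p \<in> set ps \<Longrightarrow> continuous_on S (f p)"
  shows "continuous_on S (\<lambda>x. \<Sum>p\<leftarrow>ps. f p x)"
  using assms by (induction ps) (auto intro!: continuous_on_add)

lemma norm_sum_list_le:
  fixes f :: "'b \<Rightarrow> 'a::real_normed_vector"
  assumes "\<And>p. p \<in> set ps \<Longrightarrow> norm (f p) \<le> c"
  shows "norm (\<Sum>p\<leftarrow>ps. f p) \<le> real (length ps) * c"
  using assms
  by (induction ps) (auto simp: algebra_simps intro!: order_trans[OF norm_triangle_ineq] add_mono)

lemma Deriv_Cons_eq: "(Deriv f vs has_derivative f') (at x) \<Longrightarrow> Deriv f (v # vs) x = f' v"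
  using frechet_derivative_at by fastforce

lemma Deriv_has_derivative:
  "Deriv f vs differentiable (at x) \<Longrightarrow> (Deriv f vs has_derivative (\<lambda>h. Deriv f (h # vs) x)) (at x)"
  by (simp add: frechet_derivative_works)

text \<open>\<open>Q\<close> is any pointwise choice of roots near the identity; its smoothness is
  derived inside the locale.\<close>

locale congruence_root =
  fixes D :: "real^'n::{finite,wellorder}^'n::{finite,wellorder}"
    and W :: "'a::euclidean_space set"
    and B Q :: "'a \<Rightarrow> real^'n::{finite,wellorder}^'n::{finite,wellorder}"
    and k :: nat
  assumes D: "signature_matrix D" and W: "open W" and k: "1 \<le> k" and B: "Ck_on k W B"
    and upper: "\<And>x. x \<in> W \<Longrightarrow> Q x \<in> upper_triangular_matrices"
    and near: "\<And>x. x \<in> W \<Longrightarrow> norm (Q x - mat 1) \<le> 1/5"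
    and root: "\<And>x. x \<in> W \<Longrightarrow> cross_form D (Q x) (Q x) = B x"
begin

text \<open>Differentiating \<open>B = Q\<^sup>t D Q\<close> in the directions \<open>vs\<close> gives a linear equation for
  \<open>Deriv Q vs\<close> with this right-hand side.\<close>

definition deriv_rhs :: "'a list \<Rightarrow> 'a \<Rightarrow> real^'n::{finite,wellorder}^'n::{finite,wellorder}" where
  "deriv_rhs vs x =
     Deriv B vs x - (\<Sum>(a, b)\<leftarrow>proper_splits vs. cross_form D (Deriv Q a x) (Deriv Q b x))"

lemma Deriv_B_has_derivative:
  "length vs < k \<Longrightarrow> x \<in> W \<Longrightarrow>
    (Deriv B vs has_derivative (\<lambda>h. Deriv B (h # vs) x)) (at x)"
  by (rule Deriv_has_derivative) (use B in \<open>auto simp: Ck_on_def\<close>)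

text \<open>Increments of \<open>Q\<close> are bounded by those of \<open>B\<close>, by
  \<open>congruence_root_dist_le\<close>.\<close>

lemma Q_continuous_on: "continuous_on W Q"
  unfolding continuous_on_def
proof
  fix x assume x: "x \<in> W"
  have "continuous_on W B" using B unfolding Ck_on_def by (metis Deriv.simps(1) le0 list.size(3))
  then have "(B \<longlongrightarrow> B x) (at x within W)" using x by (auto simp: continuous_on_def)
  then have "((\<lambda>y. norm (B y - B x)) \<longlongrightarrow> 0) (at x within W)"
    by (intro tendsto_norm_zero) (simp add: LIM_zero)
  moreover have "\<forall>\<^sub>F y in at x within W. norm (Q y - Q x) \<le> norm (B y - B x)"
    unfolding eventually_at_filter
    by (rule always_eventually)
      (metis congruence_root_dist_le[OF D] upper near root x)
  ultimately have "((\<lambda>y. Q y - Q x) \<longlongrightarrow> 0) (at x within W)"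
    by (rule Lim_null_comparison[rotated])
  then show "(Q \<longlongrightarrow> Q x) (at x within W)" by (simp add: LIM_zero_iff)
qed

text \<open>The claims are proved together: the third, for the tail of a list, gives the first two
  for the list at every point of \<open>W\<close>, and that equation can then be differentiated once
  more.\<close>

lemma Deriv_Q_properties:
  assumes "length vs \<le> k" "x \<in> W"
  shows "Deriv Q vs x \<in> upper_triangular_matrices \<and>
    (vs \<noteq> [] \<longrightarrow> sym_form D (Q x) (Deriv Q vs x) = deriv_rhs vs x) \<and>
    (length vs < k \<longrightarrow> (\<exists>Q'. (Deriv Q vs has_derivative Q') (at x) \<and>
      (\<forall>h. Q' h \<in> upper_triangular_matrices \<and> sym_form D (Q x) (Q' h) = deriv_rhs (h # vs) x)))"
  using assms
proof (induction vs arbitrary: x rule: length_induct)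
  case (1 vs)
  interpret C: bounded_bilinear "cross_form D" by (rule bounded_bilinear_cross_form[OF D])
  interpret T: bounded_bilinear "sym_form D" by (rule bounded_bilinear_sym_form[OF D])
  have contQ: "isCont Q y" if "y \<in> W" for y
    using Q_continuous_on W that by (simp add: continuous_on_eq_continuous_at)
  show ?case
  proof (cases vs)
    case Nil
    have "\<exists>Q'. (Q has_derivative Q') (at x) \<and>
      (\<forall>h. Q' h \<in> upper_triangular_matrices \<and> sym_form D (Q x) (Q' h) = Deriv B [h] x)"
    proof -
      \<comment> \<open>The midpoint makes the equation for \<open>Q y - Q x\<close> exact, and
        \<open>?M x\<close> is \<open>Q x\<close>.\<close>
      let ?M = "\<lambda>y. (1/2) *\<^sub>R (Q x + Q y)"
      obtain Q' where Q': "(Q has_derivative Q') (at x)" "\<And>h. Q' h \<in> upper_triangular_matrices"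
        "\<And>h. sym_form D (?M x) (Q' h) = Deriv B [h] x"
      proof (rule sym_form_solution_has_derivative[OF D W \<open>x \<in> W\<close>, of ?M Q "\<lambda>y. B y - B x"])
        show "norm (?M y - mat 1) \<le> 1/5" if "y \<in> W" for y
          by (intro norm_midpoint_diff_le near that \<open>x \<in> W\<close>)
        show "isCont ?M x" by (intro continuous_intros contQ \<open>x \<in> W\<close>)
        show "((\<lambda>y. B y - B x) has_derivative (\<lambda>h. Deriv B [h] x)) (at x)"
          using Deriv_B_has_derivative[of "[]"] k \<open>x \<in> W\<close>
          by (auto intro!: derivative_eq_intros)
        show "sym_form D (?M y) (Q y - Q x) = B y - B x" if "y \<in> W" for y
          using cross_form_diff_eq_sym_form[OF D, of "Q y" "Q x"] root that \<open>x \<in> W\<close> by simp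
      qed (use upper in auto)
      have "?M x = Q x" by (simp flip: scaleR_2)
      then show ?thesis using Q' by auto
    qed
    then show ?thesis using Nil upper \<open>x \<in> W\<close> by (simp add: deriv_rhs_def)
  next
    case (Cons v ws)
    have ws: "length ws < length vs" "length ws < k" using Cons 1 by auto
    \<comment> \<open>The equation is needed on all of \<open>W\<close>, not only at
      \<open>x\<close>, because it is differentiated below.\<close>
    have here: "Deriv Q vs y \<in> upper_triangular_matrices \<and>
      sym_form D (Q y) (Deriv Q vs y) = deriv_rhs vs y" if y: "y \<in> W" for y
    proof -
      obtain Q' where "(Deriv Q ws has_derivative Q') (at y)"
        "Q' v \<in> upper_triangular_matrices \<and> sym_form D (Q y) (Q' v) = deriv_rhs (v # ws) y"
        using 1(1)[rule_format, OF ws(1) less_imp_le[OF ws(2)] y] ws(2) by blast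
      then show ?thesis unfolding Cons by (simp only: Deriv_Cons_eq)
    qed
    have lower: "(Deriv Q a has_derivative (\<lambda>h. Deriv Q (h # a) x)) (at x)"
      if "length a < length vs" for a
    proof -
      have "\<exists>Q'. (Deriv Q a has_derivative Q') (at x)"
        using 1(1)[rule_format, OF that _ \<open>x \<in> W\<close>] that 1(2) by auto
      then show ?thesis by (intro Deriv_has_derivative) (auto simp: differentiable_def)
    qed
    have "\<exists>Q'. (Deriv Q vs has_derivative Q') (at x) \<and>
      (\<forall>h. Q' h \<in> upper_triangular_matrices \<and> sym_form D (Q x) (Q' h) = deriv_rhs (h # vs) x)"
      if less: "length vs < k"
    proof -
      let ?F = "Deriv Q vs"
      \<comment> \<open>Subtracting the equation at \<open>x\<close> from the one at
        \<open>y\<close> makes \<open>?F y - ?F x\<close> the unknown; the last term freezes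
        \<open>?F\<close> at \<open>x\<close>, so only \<open>Q\<close> is differentiated
        there.\<close>
      let ?G = "\<lambda>y. deriv_rhs vs y - deriv_rhs vs x - sym_form D (Q y - Q x) (?F x)"
      let ?R' = "\<lambda>h. Deriv B (h # vs) x - (\<Sum>p\<leftarrow>proper_splits vs.
        cross_form D (Deriv Q (fst p) x) (Deriv Q (h # snd p) x) +
        cross_form D (Deriv Q (h # fst p) x) (Deriv Q (snd p) x))"
      have "(deriv_rhs vs has_derivative ?R') (at x)"
        unfolding deriv_rhs_def[abs_def] case_prod_beta
      proof (intro has_derivative_diff has_derivative_sum_list C.FDERIV lower)
        show "(Deriv B vs has_derivative (\<lambda>h. Deriv B (h # vs) x)) (at x)"
          by (rule Deriv_B_has_derivative[OF less \<open>x \<in> W\<close>])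
        fix p assume "p \<in> set (proper_splits vs)"
        then have "(fst p, snd p) \<in> set (proper_splits vs)" by simp
        from proper_splitsD(1-3)[OF this]
        show "length (fst p) < length vs" "length (snd p) < length vs"
          by (metis add.commute less_add_same_cancel1 length_greater_0_conv)+
      qed
      moreover have Q1: "(Q has_derivative (\<lambda>h. Deriv Q [h] x)) (at x)"
        using lower[of "[]"] Cons by simp
      have "((\<lambda>y. sym_form D (Q y - Q x) (?F x)) has_derivative
          (\<lambda>h. sym_form D (Deriv Q [h] x) (?F x))) (at x)"
        by (rule bounded_linear.has_derivative[OF T.bounded_linear_left])
          (use Q1 in \<open>auto intro!: derivative_eq_intros\<close>)
      ultimately have G: "(?G has_derivative
          (\<lambda>h. ?R' h - 0 - sym_form D (Deriv Q [h] x) (?F x))) (at x)"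
        by (intro has_derivative_diff has_derivative_const)
      obtain Q' where Q': "(?F has_derivative Q') (at x)" "\<And>h. Q' h \<in> upper_triangular_matrices"
        "\<And>h. sym_form D (Q x) (Q' h) = ?R' h - 0 - sym_form D (Deriv Q [h] x) (?F x)"
      proof (rule sym_form_solution_has_derivative[OF D W \<open>x \<in> W\<close> _ contQ _ G])
        show "sym_form D (Q y) (?F y - ?F x) = ?G y" if "y \<in> W" for y
          using here[OF that] here[OF \<open>x \<in> W\<close>] by (simp add: T.diff_right T.diff_left)
      qed (use here near \<open>x \<in> W\<close> in auto)
      \<comment> \<open>The last term supplies the two new splits \<open>([h], vs)\<close> and
        \<open>(vs, [h])\<close>; the others arise by putting \<open>h\<close> into either half of
        an old split.\<close>
      have "?R' h - 0 - sym_form D (Deriv Q [h] x) (?F x) = deriv_rhs (h # vs) x" for h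
      proof -
        have "vs \<noteq> []" using Cons by simp
        then show ?thesis
          by (simp add: deriv_rhs_def proper_splits_Cons sym_form_def sum_list_addf comp_def
              case_prod_beta del: Deriv.simps(2))
      qed
      with Q' show ?thesis by metis
    qed
    then show ?thesis using here[OF \<open>x \<in> W\<close>] by blast
  qed
qed

lemma sym_form_Deriv_Q:
  "vs \<noteq> [] \<Longrightarrow> length vs \<le> k \<Longrightarrow> x \<in> W \<Longrightarrow> sym_form D (Q x) (Deriv Q vs x) = deriv_rhs vs x"
  using Deriv_Q_properties by blast

lemma Deriv_Q_upper_triangular:
  "length vs \<le> k \<Longrightarrow> x \<in> W \<Longrightarrow> Deriv Q vs x \<in> upper_triangular_matrices"
  using Deriv_Q_properties by blast

lemma Deriv_Q_differentiable:
  "length vs < k \<Longrightarrow> x \<in> W \<Longrightarrow> Deriv Q vs differentiable (at x)"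
  using Deriv_Q_properties[of vs x] by (auto simp: differentiable_def)

text \<open>A derivative of positive order solves a linear equation whose right-hand side contains a
  derivative of \<open>B\<close> and derivatives of \<open>Q\<close> of order below
  \<open>k\<close>; the latter are differentiable, hence continuous.\<close>

lemma Ck_on_Q: "Ck_on k W Q"
  unfolding Ck_on_def
proof (intro conjI allI impI ballI)
  fix vs :: "'a list" assume vs: "length vs \<le> k"
  have low: "continuous_on W (Deriv Q a)" if "length a < k" for a
    using Deriv_Q_differentiable[OF that]
    by (meson continuous_at_imp_continuous_on differentiable_imp_continuous_within)
  show "continuous_on W (Deriv Q vs)"
  proof (cases "vs = []")
    case True then show ?thesis using Q_continuous_on by simp
  next
    case False
    show ?thesis
    proof (rule sym_form_solution_continuous_on[OF D near Q_continuous_on])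
      have "continuous_on W (deriv_rhs vs)"
        unfolding deriv_rhs_def[abs_def] case_prod_beta
      proof (intro continuous_on_diff continuous_on_sum_list low
          bounded_bilinear.continuous_on[OF bounded_bilinear_cross_form[OF D]])
        show "continuous_on W (Deriv B vs)" using B vs by (simp add: Ck_on_def)
        fix p assume "p \<in> set (proper_splits vs)"
        then have "(fst p, snd p) \<in> set (proper_splits vs)" by simp
        from proper_splitsD(1-3)[OF this] vs
        show "length (fst p) < k" "length (snd p) < k"
          by (metis add.commute less_add_same_cancel1 length_greater_0_conv order_less_le_trans)+
      qed
      then show "continuous_on W (\<lambda>y. sym_form D (Q y) (Deriv Q vs y))"
        by (rule continuous_on_eq) (simp add: sym_form_Deriv_Q[OF False vs])
    qed (use Deriv_Q_upper_triangular[OF vs] in auto)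
  qed
qed (rule Deriv_Q_differentiable)

text \<open>For \<open>i + j = p\<close> with \<open>i, j \<ge> 1\<close> the exponent \<open>i(i-1) + j(j-1)\<close> is at most \<open>(p-1)(p-2)\<close>, which
  leaves room for the factor \<open>2\<^sup>p\<close> from the number of products.\<close>

lemma norm_Deriv_Q_le:
  assumes s: "1 \<le> s"
    and bound: "\<And>vs. vs \<noteq> [] \<Longrightarrow> length vs \<le> k \<Longrightarrow> (\<forall>v\<in>set vs. norm v = 1) \<Longrightarrow> norm (Deriv B vs x) \<le> s"
    and x: "x \<in> W" and vs: "vs \<noteq> []" "length vs \<le> k" "\<forall>v\<in>set vs. norm v = 1"
  shows "norm (Deriv Q vs x) \<le> 2 ^ (length vs * (length vs - 1)) * s ^ length vs"
  using vs
proof (induction vs rule: length_induct)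
  case (1 vs)
  let ?p = "length vs" and ?c = "2 ^ ((length vs - 1) * (length vs - 2)) * s ^ length vs"
  have IH: "norm (Deriv Q c x) \<le> 2 ^ (length c * (length c - 1)) * s ^ length c"
    if "c \<noteq> []" "length c < ?p" "set c \<subseteq> set vs" for c
    using 1(1)[rule_format, OF that(2,1)] that 1(3,4) by fastforce
  have split: "norm (case ab of (a, b) \<Rightarrow> cross_form D (Deriv Q a x) (Deriv Q b x)) \<le> ?c"
    if "ab \<in> set (proper_splits vs)" for ab
  proof -
    obtain a b where ab: "ab = (a, b)" by (cases ab)
    note S = proper_splitsD[OF that[unfolded ab]]
    let ?i = "length a" and ?j = "length b"
    have ij: "0 < ?i" "0 < ?j" "?i + ?j = ?p" using S by auto
    have ij_less: "?i < ?p" "?j < ?p" using ij by linarith+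
    have "norm (Deriv Q a x) \<le> 2 ^ (?i * (?i - 1)) * s ^ ?i"
      "norm (Deriv Q b x) \<le> 2 ^ (?j * (?j - 1)) * s ^ ?j"
      by (rule IH[OF S(1) ij_less(1) S(4)], rule IH[OF S(2) ij_less(2) S(5)])
    then have "norm (Deriv Q a x) * norm (Deriv Q b x)
        \<le> (2 ^ (?i * (?i - 1)) * s ^ ?i) * (2 ^ (?j * (?j - 1)) * s ^ ?j)"
      using s by (intro mult_mono) auto
    also have "\<dots> = 2 ^ (?i * (?i - 1) + ?j * (?j - 1)) * s ^ ?p"
      by (simp add: power_add flip: ij(3))
    also have "\<dots> \<le> ?c"
    proof -
      obtain i j where "?i = Suc i" "?j = Suc j" using ij by (metis gr0_implies_Suc)
      moreover have "?p = Suc (Suc (i + j))" using calculation ij by simp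
      ultimately have "?i * (?i - 1) + ?j * (?j - 1) \<le> (?p - 1) * (?p - 2)"
        by (simp add: algebra_simps)
      then show ?thesis using s by (intro mult_right_mono power_increasing) auto
    qed
    finally show ?thesis
      using norm_cross_form_le[OF D, of "Deriv Q a x" "Deriv Q b x"] by (simp add: ab)
  qed
  have sp: "s \<le> s ^ ?p" using s \<open>vs \<noteq> []\<close> by (intro self_le_power) auto
  have c1: "s ^ ?p \<le> ?c" using s by (simp add: mult_le_cancel_right1)
  have "norm (Deriv Q vs x) \<le> norm (sym_form D (Q x) (Deriv Q vs x))"
    by (intro sym_form_bound D near x Deriv_Q_upper_triangular 1)
  also have "\<dots> \<le> norm (Deriv B vs x) + real (length (proper_splits vs)) * ?c"
    unfolding sym_form_Deriv_Q[OF 1(2,3) x] deriv_rhs_def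
    by (rule order_trans[OF norm_triangle_ineq4 add_left_mono[OF norm_sum_list_le[OF split]]])
  also have "\<dots> \<le> s ^ ?p + real (length (proper_splits vs)) * ?c"
    using bound[OF 1(2,3,4)] sp by simp
  also have "\<dots> \<le> 2 ^ (?p * (?p - 1)) * s ^ ?p"
  \<comment> \<open>For order 1 there are no products. From order 2 on, the first term and the
    \<open>2 ^ ?p - 2\<close> products together are at most \<open>2 ^ ?p * ?c\<close>, and the
    exponent inequality needed next holds.\<close>
  proof (cases "?p = 1")
    case True
    then obtain v where "vs = [v]" by (metis One_nat_def length_0_conv length_Suc_conv)
    then show ?thesis by simp
  next
    case False
    then obtain q where q: "?p = Suc (Suc q)"
      using \<open>vs \<noteq> []\<close> by (metis One_nat_def length_0_conv not0_implies_Suc)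
    have len: "real (length (proper_splits vs)) + 2 = 2 ^ ?p"
      using length_proper_splits[OF \<open>vs \<noteq> []\<close>]
      by (metis of_nat_add of_nat_numeral of_nat_power)
    have "0 \<le> ?c" using s by simp
    then have "s ^ ?p + real (length (proper_splits vs)) * ?c \<le> 2 ^ ?p * ?c"
      unfolding len[symmetric] distrib_right using c1 by linarith
    also have "\<dots> = 2 ^ (?p + (?p - 1) * (?p - 2)) * s ^ ?p"
      by (simp add: power_add)
    also have "\<dots> \<le> 2 ^ (?p * (?p - 1)) * s ^ ?p"
    proof (intro mult_right_mono power_increasing)
      show "?p + (?p - 1) * (?p - 2) \<le> ?p * (?p - 1)" unfolding q by simp
    qed (use s in auto)
    finally show ?thesis .
  qed
  finally show ?case .
qed

end

subsection \<open>The constants\<close>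

lemma Ck_norm_leD:
  assumes "Ck_norm k U f \<le> ereal K" "x \<in> U" "vs \<noteq> []" "length vs \<le> k" "\<forall>v\<in>set vs. norm v = 1"
  shows "mat_norm (Deriv f vs x) \<le> K"
proof -
  have "ereal (mat_norm (Deriv f vs x)) \<le> deriv_norm (length vs) f x"
    unfolding deriv_norm_def using assms by (intro SUP_upper) auto
  also have "\<dots> \<le> (SUP x\<in>U. deriv_norm (length vs) f x)"
    using assms by (intro SUP_upper)
  also have "\<dots> \<le> Ck_norm k U f"
    unfolding Ck_norm_def using assms by (intro Max_ge imageI) (auto simp: Suc_le_eq)
  also have "\<dots> \<le> ereal K" by fact
  finally show ?thesis by simp
qed

lemma deriv_norm_leI:
  assumes "\<And>vs. length vs = p \<Longrightarrow> \<forall>v\<in>set vs. norm v = 1 \<Longrightarrow> mat_norm (Deriv f vs x) \<le> C"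
  shows "deriv_norm p f x \<le> ereal C"
  unfolding deriv_norm_def using assms by (intro SUP_least) auto

lemma Ck_norm_leI:
  assumes "1 \<le> k" "\<And>p x. 1 \<le> p \<Longrightarrow> p \<le> k \<Longrightarrow> x \<in> U \<Longrightarrow> deriv_norm p f x \<le> ereal C"
  shows "Ck_norm k U f \<le> ereal C"
  unfolding Ck_norm_def using assms by (auto intro!: SUP_least)

text \<open>Keep the summand \<open>i = 1\<close> and the first argument of the maximum.\<close>

lemma E_bound_ge:
  assumes "1 \<le> k" "0 \<le> Kf" "0 \<le> Kg" shows "Kg * Kf \<le> E_bound Kf Kg k"
proof -
  have "real 1 ^ k \<le> (\<Sum>i = 1..k. real i ^ k)"
    by (rule member_le_sum) (use assms in auto)
  then have "1 * (Kg * Kf) \<le> (\<Sum>i = 1..k. real i ^ k) * (Kg * max Kf (Kf ^ k))"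
    using assms by (intro mult_mono) auto
  then show ?thesis by (simp add: E_bound_def mult.assoc)
qed

text \<open>The last term of the maximum gives \<open>L ^ m\<close> as a lower bound for
  \<open>EI_seq K L m 0\<close>, and each recursion step multiplies by at least that entry. Here
  \<open>2 \<le> m\<close> makes the index \<open>m - 1\<close> positive, as
  \<open>E_bound_ge\<close> requires.\<close>

lemma EI_seq_ge:
  assumes "1 \<le> K" "1 \<le> L" "p = 0 \<or> 2 \<le> m"
  shows "L ^ (m * p + 1) \<le> EI_seq K L m (Suc p)"
  using assms(3)
proof (induction p)
  case (Suc p)
  then have m: "2 \<le> m" by simp
  let ?X = "MAX p\<in>{0..m-1}. fact p * L ^ (p + 1)"
  have "1 * L ^ m \<le> fact (m - 1) * L ^ (m - 1 + 1)"
    using m assms(2) by (intro mult_mono) auto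
  also have "\<dots> \<le> ?X" by (intro Max_ge imageI) auto
  finally have X: "L ^ m \<le> ?X" by simp
  have X0: "0 \<le> ?X" by (rule order_trans[OF _ X]) (use assms(2) in simp)
  note X
  also have "?X \<le> ?X * K"
    using mult_left_mono[OF assms(1) X0] by simp
  also have "\<dots> \<le> E_bound K ?X (m - 1)"
    by (intro E_bound_ge X0) (use m assms(1) in auto)
  finally have M0: "L ^ m \<le> EI_seq K L m 0" by simp
  have M1: "L ^ (m * p + 1) \<le> EI_seq K L m (Suc p)" using Suc by simp
  have "L ^ (m * Suc p + 1) = L ^ m * L ^ (m * p + 1)"
    by (simp flip: power_add)
  also have "\<dots> \<le> EI_seq K L m 0 * EI_seq K L m (Suc p)"
    using assms M0 M1 by (intro mult_mono order_trans[OF _ M0]) auto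
  also have "\<dots> \<le> EI_seq K L m (Suc (Suc p))"
    unfolding EI_seq.simps(3) using assms
    by (intro E_bound_ge order_trans[OF _ M0] order_trans[OF _ M1]) auto
  finally show ?case .
qed simp

text \<open>Since the argument \<open>L\<close> of \<open>EI\<close> is at least
  \<open>4 * s\<close>, its power of exponent (k-1)(k-2)+1 absorbs both the powers of 2 and those of
  \<open>s\<close>.\<close>

lemma C_bound_ge:
  fixes n k :: nat and K :: real
  assumes K: "0 \<le> K" and n: "1 \<le> n" and k: "2 \<le> k"
  defines "s \<equiv> sqrt (real n) * (K + 1)"
  shows "2 ^ (k * (k - 1)) * s ^ k \<le> C_bound K n k"
proof -
  define L where "L = (K + 1) * (1 + (K + 2) * real n * (real n + 1))"
  have n1: "1 \<le> real n" using n by simp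
  have "0 \<le> (real n - 1)\<^sup>2 + (real n)\<^sup>2" by simp
  then have "4 * real n \<le> 1 + 2 * real n * (real n + 1)"
    by (simp add: power2_eq_square algebra_simps)
  also have "\<dots> \<le> 1 + (K + 2) * real n * (real n + 1)"
    using K n1 by (intro add_left_mono mult_right_mono) auto
  finally have L: "4 * real n * (K + 1) \<le> L"
    unfolding L_def using K mult_left_mono[of _ _ "K + 1"] by (simp add: mult.commute)
  have "sqrt (real n) \<le> real n" using n1 by (intro real_le_lsqrt) (auto simp: power2_eq_square)
  then have "s \<le> real n * (K + 1)" unfolding s_def using K by (intro mult_right_mono) auto
  then have sL: "4 * s \<le> L" using L by simp
  have s1: "1 \<le> s"
    unfolding s_def using K n1 mult_mono[of 1 "sqrt (real n)" 1 "K + 1"] by simp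
  have L1: "1 \<le> L" using sL s1 by simp
  obtain j where j: "k = Suc (Suc j)" using k by (metis add_2_eq_Suc le_Suc_ex)
  have EI: "L ^ (Suc j * j + 1) \<le> EI (K + 1) L (k - 1)"
    unfolding EI_def j diff_Suc_1 by (rule EI_seq_ge) (use K L1 in auto)
  have "2 ^ (k * (k - 1)) * s ^ k \<le> 2 ^ (k - 1) * (K + 1) * L ^ (Suc j * j + 1)"
  \<comment> \<open>For \<open>k = 2\<close> the exponent of \<open>L\<close> is only 1, so the
    prefactor \<open>K + 1\<close> is needed to reach \<open>s ^ 2\<close>. For larger
    \<open>k\<close> the exponent of \<open>L\<close> is at least \<open>k\<close>.\<close>
  proof (cases "j = 0")
    case True
    have "s ^ 2 = real n * (K + 1) * (K + 1)"
      by (simp add: s_def power_mult_distrib power2_eq_square)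
    also have "4 * \<dots> \<le> L * (K + 1)" using mult_right_mono[OF L, of "K + 1"] K by (simp add: mult_ac)
    finally have "4 * s ^ 2 \<le> L * (K + 1)" .
    moreover have "0 \<le> L * (K + 1)" using L1 K by simp
    ultimately show ?thesis by (simp add: j True algebra_simps power2_eq_square)
  next
    case False
    have "2 ^ (k * (k - 1)) * s ^ k \<le> 2 ^ (k - 1 + 2 * (Suc j * j + 1)) * s ^ (Suc j * j + 1)"
      using s1 False by (intro mult_mono power_increasing) (auto simp: j algebra_simps)
    also have "\<dots> = 2 ^ (k - 1) * 1 * (4 * s) ^ (Suc j * j + 1)"
      by (simp only: power_add power_mult power_mult_distrib) simp
    also have "\<dots> \<le> 2 ^ (k - 1) * (K + 1) * L ^ (Suc j * j + 1)"
      using K s1 sL by (intro mult_mono power_mono) auto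
    finally show ?thesis .
  qed
  also have "\<dots> \<le> C_bound K n k"
    unfolding C_bound_def L_def[symmetric] using K EI by (intro mult_left_mono) auto
  finally show ?thesis .
qed

section \<open>Construction of the local root and its bounds\<close>

lemma norm_linear_le_unit:
  fixes f :: "'a::real_normed_vector \<Rightarrow> 'b::real_normed_vector"
  assumes "linear f" "\<And>v. norm v = 1 \<Longrightarrow> norm (f v) \<le> c"
  shows "norm (f h) \<le> c * norm h"
proof (cases "h = 0")
  case True
  then show ?thesis using linear_0[OF assms(1)] by simp
next
  case False
  have "f h = norm h *\<^sub>R f (h /\<^sub>R norm h)"
    using False by (simp add: linear_scale[OF assms(1)])
  also have "norm \<dots> \<le> norm h * c"
    unfolding norm_scaleR abs_norm_cancel using False by (intro mult_left_mono assms(2)) auto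
  finally show ?thesis by (simp add: mult.commute)
qed

theorem lemma4p1:
  fixes B :: "real^'n::{finite,wellorder} \<Rightarrow> real^'n::{finite,wellorder}^'n::{finite,wellorder}"
    and U :: "(real^'n::{finite,wellorder}) set"
    and D0 :: "real^'n::{finite,wellorder}^'n::{finite,wellorder}"
    and \<epsilon> :: "'n \<Rightarrow> real"
    and K \<delta> :: real
    and n k :: nat
  assumes "n = CARD('n)"
    and "1 \<le> k"
    and "open U" and "0 \<in> U"
    and "\<And>x. x \<in> U \<Longrightarrow> B x \<in> sym_matrices"
    and "Ck_on k U B"
    and "Ck_norm k U B \<le> ereal K"
    and "\<And>i. \<epsilon> i = 1 \<or> \<epsilon> i = -1"
    and "D0 = (\<chi> i j. if i = j then \<epsilon> i else 0)"
    and "B 0 = D0"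
    and "\<delta> = 1 / (4 * (K + 1) * (K + 2) * (1 + (K + 2)\<^sup>2) * real n * (real n + 1))"
    and "\<And>x. x \<in> U \<inter> ball 0 \<delta> \<Longrightarrow> closed_segment 0 x \<subseteq> U"
  shows "\<exists>Q.
           Ck_on k (U \<inter> ball 0 \<delta>) Q \<and>
           (\<forall>x \<in> U \<inter> ball 0 \<delta>. Q x \<in> upper_triangular_matrices) \<and>
           Q 0 = mat 1 \<and>
           (\<forall>x \<in> U \<inter> ball 0 \<delta>. B x = transpose (Q x) ** D0 ** Q x) \<and>
           (\<forall>x \<in> U \<inter> ball 0 \<delta>.
              deriv_norm 1 Q x \<le> ereal ((K + 1) * (1 + (K + 2) * real n * (real n + 1)))) \<and>
           (2 \<le> k \<longrightarrow> Ck_norm k (U \<inter> ball 0 \<delta>) Q \<le> ereal (C_bound K n k))"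
proof -
  define W where "W = U \<inter> ball 0 \<delta>"
  define s where "s = sqrt (real n) * (K + 1)"
  have D: "signature_matrix D0"
    unfolding signature_matrix_def using assms(8,9) by blast
  have n1: "1 \<le> n" using assms(1) by (simp add: Suc_le_eq)
  have K: "0 \<le> K"
    using Ck_norm_leD[OF assms(7,4), of "[axis undefined 1]"] assms(2)
      mat_norm_nonneg order_trans by (auto simp: norm_axis_1)
  have normB: "norm (Deriv B vs x) \<le> sqrt (real n) * K"
    if "x \<in> U" "vs \<noteq> []" "length vs \<le> k" "\<forall>v\<in>set vs. norm v = 1" for vs x
    unfolding assms(1)
    by (rule order_trans[OF norm_le_mat_norm mult_left_mono[OF Ck_norm_leD[OF assms(7) that]]]) simp
  have pos: "0 < 4 * (K + 1) * (K + 2) * (1 + (K + 2)\<^sup>2) * real n * (real n + 1)"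
    using K n1 by (intro mult_pos_pos) (auto intro: add_pos_nonneg)
  then have \<delta>: "0 < \<delta>" unfolding assms(11) by simp
  \<comment> \<open>\<open>sqrt (real n) * K\<close> is at most \<open>real n * (K + 1)\<close>, and
    the remaining factors in the denominator of \<open>\<delta>\<close> multiply to at least
    8.\<close>
  have small: "sqrt (real n) * K * \<delta> \<le> 1/5"
  proof -
    have "sqrt (real n) \<le> real n"
      using n1 by (intro real_le_lsqrt) (auto simp: power2_eq_square)
    then have "sqrt (real n) * K \<le> real n * (K + 1)" using K by (intro mult_mono) auto
    moreover have "real n * (K + 1) * 5 \<le> real n * (K + 1) * (4 * (K + 2) * (1 + (K + 2)\<^sup>2) * (real n + 1))"
    proof (intro mult_left_mono)
      have "4 * 2 * 1 * 1 \<le> 4 * (K + 2) * (1 + (K + 2)\<^sup>2) * (real n + 1)"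
        using K by (intro mult_mono) auto
      then show "5 \<le> 4 * (K + 2) * (1 + (K + 2)\<^sup>2) * (real n + 1)" by simp
    qed (use K in auto)
    ultimately have "sqrt (real n) * K * 5
        \<le> real n * (K + 1) * (4 * (K + 2) * (1 + (K + 2)\<^sup>2) * (real n + 1))"
      by linarith
    also have "\<dots> = 4 * (K + 1) * (K + 2) * (1 + (K + 2)\<^sup>2) * real n * (real n + 1)"
      by (simp only: mult_ac)
    finally have "sqrt (real n) * K * 5
        \<le> 4 * (K + 1) * (K + 2) * (1 + (K + 2)\<^sup>2) * real n * (real n + 1)" .
    then show ?thesis unfolding assms(11) using pos by (simp add: divide_le_eq)
  qed
  have W: "open W" "0 \<in> W" "W \<subseteq> U" unfolding W_def using assms(3,4) \<delta> by auto
  have BW: "Ck_on k W B"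
    using assms(6) W(3) unfolding Ck_on_def by (meson continuous_on_subset subsetD)
  \<comment> \<open>The mean value inequality along the segment from 0 to \<open>x\<close>, which
    lies in \<open>U\<close>; the constant is the Frobenius version of the bound on the first
    derivative.\<close>
  have nearB: "norm (B x - D0) \<le> 1/5" if x: "x \<in> W" for x
  proof -
    have seg: "closed_segment 0 x \<subseteq> U" using assms(12) x by (simp add: W_def)
    have diff: "B differentiable (at y)" if "y \<in> U" for y
      using assms(2,6) that unfolding Ck_on_def by (metis Deriv.simps(1) list.size(3) less_le_trans zero_less_one)
    have "norm (B x - B 0) \<le> sqrt (real n) * K * norm (x - 0)"
    proof (rule differentiable_bound[where S = "closed_segment 0 x"])
      fix y assume "y \<in> closed_segment 0 x"
      then have y: "y \<in> U" using seg by auto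
      show "(B has_derivative frechet_derivative B (at y)) (at y within closed_segment 0 x)"
        using diff[OF y] by (simp add: frechet_derivative_works has_derivative_at_withinI)
      show "onorm (frechet_derivative B (at y)) \<le> sqrt (real n) * K"
      proof (rule onorm_le, rule norm_linear_le_unit)
        show "linear (frechet_derivative B (at y))"
          using diff[OF y] by (rule linear_frechet_derivative)
        show "norm (frechet_derivative B (at y) v) \<le> sqrt (real n) * K" if "norm v = 1" for v
          using normB[OF y, of "[v]"] that assms(2) by simp
      qed
    qed auto
    also have "\<dots> \<le> sqrt (real n) * K * \<delta>"
      using x K by (intro mult_left_mono) (auto simp: W_def)
    finally show ?thesis using small assms(10) by simp
  qed
  have "\<exists>Q. \<forall>x\<in>W. Q x \<in> upper_triangular_matrices \<and> norm (Q x - mat 1) \<le> 1/5 \<and> cross_form D0 (Q x) (Q x) = B x"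
    by (rule bchoice) (metis congruence_root_exists[OF D] assms(5) W(3) nearB subsetD)
  then obtain Q where Q: "\<And>x. x \<in> W \<Longrightarrow> Q x \<in> upper_triangular_matrices"
    "\<And>x. x \<in> W \<Longrightarrow> norm (Q x - mat 1) \<le> 1/5" "\<And>x. x \<in> W \<Longrightarrow> cross_form D0 (Q x) (Q x) = B x"
    by blast
  interpret R: congruence_root D0 W B Q k
    by unfold_locales (fact D W(1) assms(2) BW Q)+
  \<comment> \<open>\<open>mat 1\<close> is itself a root at 0, and roots near the identity are
    unique.\<close>
  have Q0: "Q 0 = mat 1"
  proof -
    have "cross_form D0 (mat 1) (mat 1) = B 0" by (simp add: cross_form_def assms(10))
    then show ?thesis
      using congruence_root_dist_le[OF D Q(1,2)[OF W(2)] mat_1_upper_triangular] Q(3)[OF W(2)]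
      by simp
  qed
  have s1: "1 \<le> s"
    unfolding s_def using K n1 mult_mono[of 1 "sqrt (real n)" 1 "K + 1"] by simp
  have Ks: "sqrt (real n) * K \<le> s" unfolding s_def by (simp add: algebra_simps)
  have bound: "mat_norm (Deriv Q vs x) \<le> 2 ^ (length vs * (length vs - 1)) * s ^ length vs"
    if "x \<in> W" "vs \<noteq> []" "length vs \<le> k" "\<forall>v\<in>set vs. norm v = 1" for vs x
    using W(3) Ks that by (intro order_trans[OF mat_norm_le_norm] R.norm_Deriv_Q_le s1)
      (auto intro: order_trans[OF normB])
  have first: "deriv_norm 1 Q x \<le> ereal ((K + 1) * (1 + (K + 2) * real n * (real n + 1)))"
    if "x \<in> W" for x
  proof (rule deriv_norm_leI)
    fix vs :: "(real^'n::{finite,wellorder}) list" assume vs: "length vs = 1" "\<forall>v\<in>set vs. norm v = 1"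
    have "mat_norm (Deriv Q vs x) \<le> s" using bound[OF that _ _ vs(2)] vs(1) assms(2) by fastforce
    also have "\<dots> \<le> real n * (K + 1)"
      unfolding s_def using K n1
      by (intro mult_right_mono real_le_lsqrt) (auto simp: power2_eq_square)
    also have "\<dots> \<le> (1 + (K + 2) * real n * (real n + 1)) * (K + 1)"
    proof (intro mult_right_mono)
      have "1 * real n * 1 \<le> (K + 2) * real n * (real n + 1)"
        using K by (intro mult_mono) auto
      then show "real n \<le> 1 + (K + 2) * real n * (real n + 1)" by simp
    qed (use K in simp)
    finally show "mat_norm (Deriv Q vs x) \<le> (K + 1) * (1 + (K + 2) * real n * (real n + 1))"
      by (simp add: mult.commute)
  qed
  have "Ck_norm k W Q \<le> ereal (C_bound K n k)" if k2: "2 \<le> k"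
  proof (intro Ck_norm_leI assms(2) deriv_norm_leI)
    fix p x and vs :: "(real^'n::{finite,wellorder}) list"
    assume p: "1 \<le> p" "p \<le> k" and x: "x \<in> W" and vs: "length vs = p" "\<forall>v\<in>set vs. norm v = 1"
    have "mat_norm (Deriv Q vs x) \<le> 2 ^ (p * (p - 1)) * s ^ p"
      using bound[OF x _ _ vs(2)] vs(1) p by fastforce
    \<comment> \<open>As \<open>1 \<le> s\<close>, the bounds increase with the order, so order
      \<open>k\<close> decides.\<close>
    also have "\<dots> \<le> 2 ^ (k * (k - 1)) * s ^ k"
      using p s1 by (intro mult_mono power_increasing) auto
    also have "\<dots> \<le> C_bound K n k"
      unfolding s_def by (rule C_bound_ge[OF K n1 k2])
    finally show "mat_norm (Deriv Q vs x) \<le> C_bound K n k" .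
  qed
  then show ?thesis
    using R.Ck_on_Q Q Q0 first unfolding W_def cross_form_def by (intro exI[of _ Q]) auto
qed

end
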